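(* Let $X, X_1, X_2, \dots$ be independent and identically distributed real-valued random variables with $\mathbb{E}[X^2]<\infty$, $\mathbb{E}X=0$, $\mathbb{V}(X)=1$, and distribution function $F$. Then, as $n\to\infty$, $$\frac{G_n^{(1)}}{n}\longrightarrow \int_{\mathbb{R}}\big(F^X(s)-F(s)\big)^2\,\omega(s)\,\mathrm{d}s=\|F^X-F\|_{L^2}^2=\Delta^{(1)}$$ and $$\frac{G_n^{(2)}}{n}\longrightarrow \int_{\mathbb{R}}\big(F^X(s)-\Phi(s)\big)^2\,\omega(s)\,\mathrm{d}s=\|F^X-\Phi\|_{L^2}^2=\Delta^{(2)},$$ each convergence being $\mathbb{P}$-almost sure.
   Context: $\omega:\mathbb{R}\to\mathbb{R}$ is a positive continuous weight function with $\int_{\mathbb{R}}t^4\,\omega(t)\,\mathrm{d}t<\infty$. $L^2=L^2(\mathbb{R},\mathcal{B},\omega\,\mathrm{d}\mathcal{L}^1)$ with $\|f\|_{L^2}^2=\int_{\mathbb{R}}f(t)^2\omega(t)\,\mathrm{d}t$. $\Phi$ is the standard normal distribution function. The zero-bias distribution function of $X$ is $F^X(t)=\mathbb{E}[X(X-t)\mathds{1}\{X\le t\}]$, $t\in\mathbb{R}$. The sample mean and variance are $\overline{X}_n=n^{-1}\sum_{k=1}^n X_k$ and $S_n^2=n^{-1}\sum_{k=1}^n(X_k-\overline{X}_n)^2$, and the scaled residuals are $Y_{n,j}=(X_j-\overline{X}_n)/S_n$, $j=1,\dots,n$ (considered when $S_n>0$, which holds almost surely for all large $n$). The test statistics are $$G_n^{(1)}=n\int_{\mathbb{R}}\Big(\frac1n\sum_{j=1}^nY_{n,j}(Y_{n,j}-t)\mathds{1}\{Y_{n,j}\le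 t\}-\frac1n\sum_{j=1}^n\mathds{1}\{Y_{n,j}\le t\}\Big)^2\omega(t)\,\mathrm{d}t,$$ $$G_n^{(2)}=n\int_{\mathbb{R}}\Big(\frac1n\sum_{j=1}^nY_{n,j}(Y_{n,j}-t)\mathds{1}\{Y_{n,j}\le t\}-\Phi(t)\Big)^2\omega(t)\,\mathrm{d}t.$$ $\Delta^{(1)}$ and $\Delta^{(2)}$ are defined by the displayed limits in the claim. *)

theory Defs
  imports "HOL-Probability.Probability"
begin

text \<open>Samples are 1-based: \<open>x 1, \<dots>, x n\<close> are the observations, and \<open>x 0\<close> is never used.\<close>

definition sample_mean :: "nat \<Rightarrow> (nat \<Rightarrow> real) \<Rightarrow> real" where
  "sample_mean n x = (\<Sum>k=1..n. x k) / real n"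

definition sample_variance :: "nat \<Rightarrow> (nat \<Rightarrow> real) \<Rightarrow> real" where
  "sample_variance n x = (\<Sum>k=1..n. (x k - sample_mean n x)\<^sup>2) / real n"

text \<open>The residuals are meaningful only if \<open>sample_variance n x > 0\<close>; otherwise they are \<open>0\<close>
  because division by zero yields zero.\<close>

definition scaled_residual :: "nat \<Rightarrow> (nat \<Rightarrow> real) \<Rightarrow> nat \<Rightarrow> real" where
  "scaled_residual n x j = (x j - sample_mean n x) / sqrt (sample_variance n x)"

definition zero_bias_cdf :: "'a measure \<Rightarrow> ('a \<Rightarrow> real) \<Rightarrow> real \<Rightarrow> real" where
  "zero_bias_cdf M X t = (LINT w|M. X w * (X w - t) * indicator {..t} (X w))"

definition empirical_zero_bias :: "nat \<Rightarrow> (nat \<Rightarrow> real) \<Rightarrow> real \<Rightarrow> real" where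
  "empirical_zero_bias n y t = (\<Sum>j=1..n. y j * (y j - t) * indicator {..t} (y j)) / real n"

definition empirical_cdf :: "nat \<Rightarrow> (nat \<Rightarrow> real) \<Rightarrow> real \<Rightarrow> real" where
  "empirical_cdf n y t = (\<Sum>j=1..n. indicator {..t} (y j)) / real n"

definition std_normal_cdf :: "real \<Rightarrow> real" where
  "std_normal_cdf = cdf std_normal_distribution"

definition G1 :: "(real \<Rightarrow> real) \<Rightarrow> nat \<Rightarrow> (nat \<Rightarrow> real) \<Rightarrow> real" where
  "G1 \<omega> n x = real n * (LINT t|lborel.
     (empirical_zero_bias n (scaled_residual n x) t - empirical_cdf n (scaled_residual n x) t)\<^sup>2 * \<omega> t)"

definition G2 :: "(real \<Rightarrow> real) \<Rightarrow> nat \<Rightarrow> (nat \<Rightarrow> real) \<Rightarrow> real" where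
  "G2 \<omega> n x = real n * (LINT t|lborel.
     (empirical_zero_bias n (scaled_residual n x) t - std_normal_cdf t)\<^sup>2 * \<omega> t)"

definition L2_space :: "(real \<Rightarrow> real) \<Rightarrow> (real \<Rightarrow> real) set" where
  "L2_space \<omega> = {f \<in> borel_measurable borel. integrable lborel (\<lambda>t. (f t)\<^sup>2 * \<omega> t)}"

definition L2_norm :: "(real \<Rightarrow> real) \<Rightarrow> (real \<Rightarrow> real) \<Rightarrow> real" where
  "L2_norm \<omega> f = sqrt (LINT t|lborel. (f t)\<^sup>2 * \<omega> t)"

definition Delta1 :: "(real \<Rightarrow> real) \<Rightarrow> 'a measure \<Rightarrow> ('a \<Rightarrow> real) \<Rightarrow> real" where
  "Delta1 \<omega> M X = (L2_norm \<omega> (\<lambda>s. zero_bias_cdf M X s - cdf (distr M borel X) s))\<^sup>2"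

definition Delta2 :: "(real \<Rightarrow> real) \<Rightarrow> 'a measure \<Rightarrow> ('a \<Rightarrow> real) \<Rightarrow> real" where
  "Delta2 \<omega> M X = (L2_norm \<omega> (\<lambda>s. zero_bias_cdf M X s - std_normal_cdf s))\<^sup>2"

end

theory Submission
  imports Defs
begin

text \<open>
  Since \<open>y (y - t) 1{y \<le> t} = - y max 0 (t - y)\<close> is Lipschitz in \<open>t\<close> with constant \<open>\<bar>y\<bar>\<close>, almost sure
  convergence of the empirical zero-bias function of the sample at rational points extends to all
  points and survives the replacement of \<open>t\<close> by the random threshold \<open>mean + sd * t\<close> that results
  from standardization.  The empirical distribution function is monotone, so the same holds
  at continuity points of \<open>F\<close>.  The residuals have mean square at most \<open>1\<close>, which bounds the integrands by
  \<open>(2 + \<bar>t\<bar>)\<^sup>2 \<omega> t\<close>, and dominated convergence applies path by path.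

  The pointwise limits need the strong law of large numbers under a mere first moment.  If \<open>E h < 0\<close>,
  let \<open>M n\<close> be the maximum of \<open>0\<close> and the first \<open>n\<close> partial sums of \<open>h\<close>.  The event \<open>A\<close> that \<open>M n\<close>
  is unbounded is shift invariant, and \<open>M (n + 1) - M n \<circ> shift = max (- M n \<circ> shift) h\<close> has nonnegative
  integral over \<open>A\<close> and tends to \<open>h\<close> there; hence \<open>E h * P A \<ge> 0\<close>, so \<open>P A = 0\<close>.  Applying this to
  \<open>h = \<plusminus>(f - E f) - \<epsilon>\<close> gives the law.
\<close>

subsection \<open>The strong law of large numbers\<close>

text \<open>This is the stationarity behind the strong law: an independent draw put in front of a
  random stream leaves its law unchanged, because integrals over streams can be computed by
  splitting off the head.\<close>

lemma (in prob_space) distr_Stream_stream_space: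
  "distr (M \<Otimes>\<^sub>M stream_space M) (stream_space M) (\<lambda>(x, s). x ## s) = stream_space M"
proof (rule measure_eqI)
  interpret S: prob_space "stream_space M" by (rule prob_space_stream_space)
  interpret P: pair_prob_space M "stream_space M" ..
  fix A assume "A \<in> sets (distr (M \<Otimes>\<^sub>M stream_space M) (stream_space M) (\<lambda>(x, s). x ## s))"
  then have A[measurable]: "A \<in> sets (stream_space M)" by simp
  have "emeasure (distr (M \<Otimes>\<^sub>M stream_space M) (stream_space M) (\<lambda>(x, s). x ## s)) A
      = (\<integral>\<^sup>+s. indicator A s \<partial>distr (M \<Otimes>\<^sub>M stream_space M) (stream_space M) (\<lambda>(x, s). x ## s))"
    by (subst nn_integral_indicator) auto
  also have "\<dots> = (\<integral>\<^sup>+p. indicator A (case p of (x, s) \<Rightarrow> x ## s) \<partial>(M \<Otimes>\<^sub>M stream_space M))"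
    by (subst nn_integral_distr) auto
  also have "\<dots> = (\<integral>\<^sup>+x. \<integral>\<^sup>+s. indicator A (x ## s) \<partial>stream_space M \<partial>M)"
    by (subst S.nn_integral_fst[symmetric]) auto
  also have "\<dots> = emeasure (stream_space M) A"
    using nn_integral_stream_space[of "indicator A"] by simp
  finally show "emeasure (distr (M \<Otimes>\<^sub>M stream_space M) (stream_space M) (\<lambda>(x, s). x ## s)) A
      = emeasure (stream_space M) A" .
qed simp

section \<open>Maximal partial sums along a stream\<close>

text \<open>Unfolding the recursion gives the maximum over \<open>k \<le> n\<close> of the sums of the first \<open>k\<close> values of \<open>h\<close>.\<close>

primrec max_partial_sum :: "('a \<Rightarrow> real) \<Rightarrow> nat \<Rightarrow> 'a stream \<Rightarrow> real" where
  "max_partial_sum h 0 s = 0"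
| "max_partial_sum h (Suc n) s = max 0 (h (shd s) + max_partial_sum h n (stl s))"

lemma max_partial_sum_0: "max_partial_sum h 0 = (\<lambda>_. 0)"
  by (simp add: fun_eq_iff)

lemma max_partial_sum_nonneg: "0 \<le> max_partial_sum h n s"
  by (cases n) auto

lemma max_partial_sum_Suc_mono: "max_partial_sum h n s \<le> max_partial_sum h (Suc n) s"
proof (induction n arbitrary: s)
  case (Suc n)
  have "max 0 (h (shd s) + max_partial_sum h n (stl s))
      \<le> max 0 (h (shd s) + max_partial_sum h (Suc n) (stl s))"
    by (intro max.mono order_refl add_left_mono Suc)
  then show ?case by (simp only: max_partial_sum.simps(2)[of _ _ s])
qed simp

lemma max_partial_sum_mono: "m \<le> n \<Longrightarrow> max_partial_sum h m s \<le> max_partial_sum h n s"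
  by (rule lift_Suc_mono_le[of "\<lambda>n. max_partial_sum h n s"]) (rule max_partial_sum_Suc_mono)

lemma sum_le_max_partial_sum: "(\<Sum>k<n. h (s !! k)) \<le> max_partial_sum h n s"
proof (induction n arbitrary: s)
  case (Suc n)
  have "(\<Sum>k<Suc n. h (s !! k)) = h (shd s) + (\<Sum>k<n. h (stl s !! k))"
    by (subst sum.lessThan_Suc_shift) simp
  with Suc[of "stl s"] show ?case by simp
qed simp

lemma measurable_max_partial_sum [measurable]:
  assumes [measurable]: "h \<in> borel_measurable M"
  shows "max_partial_sum h n \<in> borel_measurable (stream_space M)"
proof (induction n)
  case (Suc n)
  note [measurable] = Suc
  have "max_partial_sum h (Suc n) = (\<lambda>s. max 0 (h (shd s) + max_partial_sum h n (stl s)))"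
    by (simp add: fun_eq_iff)
  also have "\<dots> \<in> borel_measurable (stream_space M)" by measurable
  finally show ?case .
qed (simp add: max_partial_sum_0)

text \<open>The shift argument is in the style of Garsia's proof of the maximal ergodic theorem. A
  point \<open>(x, s)\<close> of the product is read as the stream \<open>x ## s\<close> with shift
  \<open>s\<close>, so head and tail are independent by construction.\<close>

lemma AE_max_partial_sum_bounded:
  assumes "prob_space M" and h: "integrable M h" and neg: "integral\<^sup>L M h < 0"
  shows "AE s in stream_space M. \<exists>B. \<forall>n. max_partial_sum h n s \<le> B"
proof -
  interpret prob_space M by fact
  let ?S = "stream_space M" and ?m = "max_partial_sum h"
  let ?P = "M \<Otimes>\<^sub>M ?S"
  interpret S: prob_space ?S by (rule prob_space_stream_space)
  interpret P: pair_prob_space M ?S ..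
  have [measurable]: "h \<in> borel_measurable M" using h by simp
  \<comment> \<open>Bounds range over the naturals so that unboundedness is a countable combination
    of measurable conditions.\<close>
  define A where "A = {s \<in> space ?S. \<not> (\<exists>B::nat. \<forall>n. ?m n s \<le> B)}"
  have A[measurable]: "A \<in> sets ?S" unfolding A_def by measurable
  have A_Stream: "x ## s \<in> A \<longleftrightarrow> s \<in> A" if "x \<in> space M" "s \<in> space ?S" for x s
  proof -
    have "(\<exists>B::nat. \<forall>n. ?m n (x ## s) \<le> B) \<longleftrightarrow> (\<exists>B::nat. \<forall>n. ?m n s \<le> B)"
    proof safe
      fix B :: nat assume B: "\<forall>n. ?m n (x ## s) \<le> B"
      obtain B' :: nat where B': "B - h x \<le> B'" using real_arch_simple by blast
      have "?m n s \<le> B'" for n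
        using B[rule_format, of "Suc n"] B' by simp
      then show "\<exists>B::nat. \<forall>n. ?m n s \<le> B" by blast
    next
      fix B :: nat assume B: "\<forall>n. ?m n s \<le> B"
      \<comment> \<open>\<open>max 0\<close> covers the cut-off in the recursion and the index
        \<open>n = 0\<close>, where \<open>n - 1\<close> truncates.\<close>
      obtain B' :: nat where B': "max 0 (h x + B) \<le> B'" using real_arch_simple by blast
      have "?m n (x ## s) \<le> B'" for n
        using B[rule_format, of "n - 1"] B' by (cases n) auto
      then show "\<exists>B::nat. \<forall>n. ?m n (x ## s) \<le> B" by blast
    qed
    moreover have "x ## s \<in> space ?S" using that by (simp add: space_stream_space)
    ultimately show ?thesis using that(2) by (simp only: A_def mem_Collect_eq simp_thms)
  qed
  have fst: "distr ?P M fst = M" by (rule S.distr_pair_fst)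
  have snd: "distr ?P ?S snd = ?S"
  proof -
    have "distr ?P ?S snd = distr (distr (?S \<Otimes>\<^sub>M M) ?P (\<lambda>(x, y). (y, x))) ?S snd"
      by (simp only: P.distr_pair_swap[symmetric])
    also have "\<dots> = distr (?S \<Otimes>\<^sub>M M) ?S (snd \<circ> (\<lambda>(x, y). (y, x)))"
      by (rule distr_distr) measurable
    also have "snd \<circ> (\<lambda>(x, y). (y, x)) = (fst :: 'a stream \<times> 'a \<Rightarrow> 'a stream)"
      by (simp add: fun_eq_iff)
    finally show ?thesis by (simp add: distr_pair_fst)
  qed
  have int_fst: "integrable ?P (\<lambda>p. f (fst p))" if "integrable M f" for f :: "_ \<Rightarrow> real"
    using that integrable_distr[of fst ?P M f] by (simp add: fst)
  have int_snd: "integrable ?P (\<lambda>p. f (snd p))" if "integrable ?S f" for f :: "_ \<Rightarrow> real"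
    using that integrable_distr[of snd ?P ?S f] by (simp add: snd)
  have Stream_meas[measurable]: "(\<lambda>(x, s). x ## s) \<in> ?P \<rightarrow>\<^sub>M ?S" by measurable
  have int_Stream: "integrable ?S f \<longleftrightarrow> integrable ?P (\<lambda>p. f (fst p ## snd p))"
    if "f \<in> borel_measurable ?S" for f :: "_ \<Rightarrow> real"
    using integrable_distr_eq[OF Stream_meas that]
    by (simp add: distr_Stream_stream_space split_beta)
  have integral_Stream: "integral\<^sup>L ?S f = (LINT p|?P. f (fst p ## snd p))"
    if "f \<in> borel_measurable ?S" for f :: "_ \<Rightarrow> real"
    using integral_distr[OF Stream_meas that]
    by (simp add: distr_Stream_stream_space split_beta)
  \<comment> \<open>Integrability climbs along the recursion: by stationarity
    \<open>?m (Suc n)\<close> may be integrated over head and tail, where it is built from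
    integrable functions.\<close>
  have int_m: "integrable ?S (?m n)" for n
  proof (induction n)
    case (Suc n)
    have "integrable ?P (\<lambda>p. max 0 (h (fst p) + ?m n (snd p)))"
      by (intro integrable_max Bochner_Integration.integrable_add int_fst int_snd h Suc) simp
    then show ?case by (subst int_Stream) auto
  qed (simp add: max_partial_sum_0)
  \<comment> \<open>\<open>g n\<close> is the increment of the maximal sum from \<open>n\<close> terms of the tail to \<open>n + 1\<close> terms of the
    whole stream; by stationarity its integral is that of the increment at a fixed stream, hence nonnegative.\<close>
  define g where "g n p = max (- ?m n (snd p)) (h (fst p)) * indicator A (snd p)" for n p
  have g_nonneg: "0 \<le> integral\<^sup>L ?P (g n)" for n
  proof -
    have iA: "integrable ?S (\<lambda>s. ?m k s * indicator A s)" for k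
      by (intro integrable_real_mult_indicator int_m A)
    have "0 \<le> (LINT s|?S. ?m (Suc n) s * indicator A s) - (LINT s|?S. ?m n s * indicator A s)"
      using max_partial_sum_Suc_mono[of h n]
      by (subst Bochner_Integration.integral_diff[symmetric])
         (auto intro!: iA integral_nonneg simp del: max_partial_sum.simps simp: mult_right_mono)
    also have "(LINT s|?S. ?m (Suc n) s * indicator A s)
        = (LINT p|?P. ?m (Suc n) (fst p ## snd p) * indicator A (snd p))"
      by (subst integral_Stream)
         (auto intro!: Bochner_Integration.integral_cong simp: space_pair_measure A_Stream indicator_def simp del: max_partial_sum.simps)
    also have "(LINT s|?S. ?m n s * indicator A s)
        = (LINT p|?P. ?m n (snd p) * indicator A (snd p))"
      by (subst snd[symmetric], subst integral_distr) auto
    \<comment> \<open>Here \<open>max 0 (a + m) - m = max (- m) a\<close>, with \<open>a\<close> the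
      value of \<open>h\<close> at the head and \<open>m\<close> the maximal sum of the
      tail.\<close>
    also have "(LINT p|?P. ?m (Suc n) (fst p ## snd p) * indicator A (snd p)) - \<dots> = integral\<^sup>L ?P (g n)"
    proof (subst Bochner_Integration.integral_diff[symmetric])
      show "integrable ?P (\<lambda>p. ?m n (snd p) * indicator A (snd p))"
        by (rule int_snd) (rule iA)
      have "integrable ?P (\<lambda>p. ?m (Suc n) (fst p ## snd p) * indicator A (fst p ## snd p))"
        using iA[of "Suc n"] by (subst (asm) int_Stream) (auto simp del: max_partial_sum.simps)
      then show "integrable ?P (\<lambda>p. ?m (Suc n) (fst p ## snd p) * indicator A (snd p))"
        by (rule iffD1[OF Bochner_Integration.integrable_cong, rotated 2])
           (auto simp: space_pair_measure A_Stream indicator_def simp del: max_partial_sum.simps)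
    qed (auto intro!: Bochner_Integration.integral_cong simp: g_def indicator_def max_def)
    finally show ?thesis .
  qed
  \<comment> \<open>Since \<open>m \<ge> 0\<close>, \<open>max (- m) a\<close> is at most
    \<open>\<bar>a\<bar>\<close> in absolute value, which supplies the dominating function.\<close>
  have "(\<lambda>n. integral\<^sup>L ?P (g n)) \<longlonglongrightarrow> (LINT p|?P. h (fst p) * indicator A (snd p))"
  proof (rule integral_dominated_convergence[where w = "\<lambda>p. \<bar>h (fst p)\<bar>"])
    show "integrable ?P (\<lambda>p. \<bar>h (fst p)\<bar>)"
      by (intro integrable_abs int_fst h)
    show "AE p in ?P. norm (g n p) \<le> \<bar>h (fst p)\<bar>" for n
    proof (intro AE_I2)
      fix p show "norm (g n p) \<le> \<bar>h (fst p)\<bar>"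
        using max_partial_sum_nonneg[of h n "snd p"] by (auto simp: g_def indicator_def max_def abs_if)
    qed
    show "AE p in ?P. (\<lambda>n. g n p) \<longlonglongrightarrow> h (fst p) * indicator A (snd p)"
    proof (intro AE_I2)
      fix p
      show "(\<lambda>n. g n p) \<longlonglongrightarrow> h (fst p) * indicator A (snd p)"
      proof (cases "snd p \<in> A")
        case True
        obtain B :: nat where "- h (fst p) \<le> B" using real_arch_simple by blast
        moreover obtain N where "B < ?m N (snd p)" using True by (force simp: A_def not_le)
        ultimately have "- h (fst p) \<le> ?m n (snd p)" if "n \<ge> N" for n
          using max_partial_sum_mono[OF that, of h "snd p"] by linarith
        then have "\<forall>\<^sub>F n in sequentially. g n p = h (fst p) * indicator A (snd p)"
          by (intro eventually_sequentiallyI[of N]) (force simp: g_def max_def)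
        then show ?thesis by (rule tendsto_eventually)
      qed (simp add: g_def)
    qed
  qed (auto simp: g_def[abs_def])
  then have "0 \<le> (LINT p|?P. h (fst p) * indicator A (snd p))"
    by (rule LIMSEQ_le_const) (use g_nonneg in auto)
  \<comment> \<open>By Fubini the integral factors into \<open>E h\<close> and the probability of
    \<open>A\<close>; as \<open>E h < 0\<close>, its nonnegativity forces that probability to be
    \<open>0\<close>.\<close>
  also have "\<dots> = (LINT x|M. (LINT s|?S. h x * indicator A s))"
  proof (subst P.integral_fst'[symmetric])
    show "integrable ?P (\<lambda>p. h (fst p) * indicator A (snd p))"
      by (rule Bochner_Integration.integrable_bound[OF integrable_abs[OF int_fst[OF h]]])
         (auto simp: indicator_def)
  qed simp
  also have "\<dots> = integral\<^sup>L M h * measure ?S A" by simp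
  finally have "measure ?S A = 0"
    using neg by (simp add: zero_le_mult_iff measure_le_0_iff)
  then have "A \<in> null_sets ?S" by (simp add: null_sets_def S.emeasure_eq_measure)
  then have "AE s in ?S. s \<notin> A" by (rule AE_not_in)
  then show ?thesis by (rule AE_mp) (auto intro!: AE_I2 simp: A_def)
qed

text \<open>For \<open>d\<close> strictly between the mean and \<open>c\<close>,
  \<open>f - d\<close> has negative mean, so its partial sums stay below some \<open>B\<close> and
  the average is at most \<open>d + B / n\<close>, which drops below \<open>c\<close>.\<close>

lemma AE_stream_average_le:
  assumes "prob_space M" and f: "integrable M f" and c: "integral\<^sup>L M f < c"
  shows "AE s in stream_space M. \<forall>\<^sub>F n in sequentially. (\<Sum>k<n. f (s !! k)) / real n \<le> c"
proof -
  interpret prob_space M by fact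
  obtain d where d: "integral\<^sup>L M f < d" "d < c" using dense[OF c] by blast
  have "AE s in stream_space M. \<exists>B. \<forall>n. max_partial_sum (\<lambda>x. f x - d) n s \<le> B"
    using f d(1) by (intro AE_max_partial_sum_bounded assms(1)) (auto simp: prob_space)
  then show ?thesis
  proof eventually_elim
    case (elim s)
    then obtain B where B: "\<And>n. max_partial_sum (\<lambda>x. f x - d) n s \<le> B" by blast
    \<comment> \<open>For \<open>n > N\<close> the error \<open>B / n\<close> is below the slack
      \<open>c - d\<close>; starting at \<open>Suc N\<close> also keeps \<open>n\<close>
      positive.\<close>
    obtain N where N: "B / (c - d) < of_nat N" using reals_Archimedean2 by blast
    have "(\<Sum>k<n. f (s !! k)) / real n \<le> c" if n: "n \<ge> Suc N" for n
    proof -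
      have "(\<Sum>k<n. f (s !! k)) - n * d \<le> B"
        using sum_le_max_partial_sum[where h="\<lambda>x. f x - d" and n=n and s=s] B[of n]
        by (simp add: sum_subtractf)
      moreover have "B < n * (c - d)"
        proof -
        have "B < real N * (c - d)" using N d(2) by (simp add: pos_divide_less_eq)
        also have "\<dots> \<le> n * (c - d)" using n d(2) by (intro mult_right_mono) auto
        finally show ?thesis .
      qed
      ultimately show ?thesis using n by (simp add: field_simps)
    qed
    then show ?case unfolding eventually_sequentially by blast
  qed
qed

text \<open>Upper bounds for the averages of \<open>f\<close> and \<open>- f\<close> give both
  inequalities; the slacks \<open>1 / Suc i\<close> keep the number of exceptional null sets
  countable.\<close>

lemma strong_law_stream_space:
  assumes "prob_space M" and f: "integrable M f"
  shows "AE s in stream_space M. (\<lambda>n. (\<Sum>k<n. f (s !! k)) / real n) \<longlonglongrightarrow> integral\<^sup>L M f"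
proof -
  have "AE s in stream_space M. \<forall>i. \<forall>\<^sub>F n in sequentially. (\<Sum>k<n. f (s !! k)) / real n \<le> integral\<^sup>L M f + 1 / Suc i"
    unfolding AE_all_countable
    by (intro allI AE_stream_average_le assms) simp
  moreover have "AE s in stream_space M. \<forall>i. \<forall>\<^sub>F n in sequentially. (\<Sum>k<n. - f (s !! k)) / real n \<le> - integral\<^sup>L M f + 1 / Suc i"
    unfolding AE_all_countable
    by (intro allI AE_stream_average_le assms) (simp_all add: f)
  ultimately show ?thesis
  proof eventually_elim
    case (elim s)
    show ?case
    proof (rule tendstoI)
      fix e :: real assume "e > 0"
      then obtain i where i: "1 / Suc i < e" using nat_approx_posE by auto
      show "\<forall>\<^sub>F n in sequentially. dist ((\<Sum>k<n. f (s !! k)) / real n) (integral\<^sup>L M f) < e"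
        using elim(1)[rule_format, of i] elim(2)[rule_format, of i]
        by eventually_elim (use i in \<open>simp add: dist_real_def sum_negf abs_less_iff\<close>)
    qed
  qed
qed

text \<open>Independence with a common law means that the whole sequence has the product measure as
  its law, which \<open>to_stream\<close> carries to \<open>stream_space D\<close>; the almost sure
  statement about streams is then pulled back.\<close>

lemma (in prob_space) strong_law_of_large_numbers:
  assumes ind: "indep_vars (\<lambda>_. N) X (UNIV :: nat set)"
    and D: "\<And>k. distr M N (X k) = D" and f: "integrable D f"
  shows "AE w in M. (\<lambda>n. (\<Sum>k<n. f (X k w)) / real n) \<longlonglongrightarrow> integral\<^sup>L D f"
proof -
  have X[measurable]: "X k \<in> M \<rightarrow>\<^sub>M N" for k
    using ind by (simp add: indep_vars_def)
  have sets_D[measurable_cong]: "sets D = sets N" unfolding D[of 0, symmetric] by simp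
  have "prob_space D" unfolding D[of 0, symmetric] by (rule prob_space_distr) simp
  interpret D: prob_space D by fact
  have [measurable]: "(\<lambda>w k. X k w) \<in> M \<rightarrow>\<^sub>M PiM UNIV (\<lambda>_. D)"
    by (rule measurable_PiM_single') (auto simp: sets_eq_imp_space_eq[OF sets_D] dest: measurable_space[OF X])
  have "distr M (PiM UNIV (\<lambda>_. D)) (\<lambda>w k. X k w) = distr M (PiM UNIV (\<lambda>_. N)) (\<lambda>w k. X k w)"
    by (intro distr_cong sets_PiM_cong sets_D refl)
  also have "\<dots> = PiM UNIV (\<lambda>_. D)"
    using indep_vars_iff_distr_eq_PiM[THEN iffD1, OF _ _ ind] X by (simp add: D restrict_UNIV)
  finally have PiM: "distr M (PiM UNIV (\<lambda>_. D)) (\<lambda>w k. X k w) = PiM UNIV (\<lambda>_. D)" .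
  have "distr M (stream_space D) (\<lambda>w. to_stream (\<lambda>k. X k w))
      = distr (distr M (PiM UNIV (\<lambda>_. D)) (\<lambda>w k. X k w)) (stream_space D) to_stream"
    by (subst distr_distr) (simp_all add: comp_def)
  also have "\<dots> = stream_space D"
    by (simp only: PiM stream_space_eq_distr[symmetric])
  finally have *: "distr M (stream_space D) (\<lambda>w. to_stream (\<lambda>k. X k w)) = stream_space D" .
  have "AE s in distr M (stream_space D) (\<lambda>w. to_stream (\<lambda>k. X k w)).
      (\<lambda>n. (\<Sum>k<n. f (s !! k)) / real n) \<longlonglongrightarrow> integral\<^sup>L D f"
    unfolding * by (rule strong_law_stream_space) fact+
  then show ?thesis
    by (rule AE_distrD[rotated, THEN AE_mp])
       (measurable, auto intro!: AE_I2 simp: to_stream_def)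
qed


text \<open>The sum over \<open>1..n\<close> is a sum of \<open>n + 1\<close> terms without
  \<open>a 0\<close>; neither \<open>a 0 / n\<close> nor the factor \<open>(n + 1) / n\<close>
  affects the limit.\<close>

lemma tendsto_average_from_1:
  fixes a :: "nat \<Rightarrow> real"
  assumes "(\<lambda>n. (\<Sum>k<n. a k) / real n) \<longlonglongrightarrow> l"
  shows "(\<lambda>n. (\<Sum>k=1..n. a k) / real n) \<longlonglongrightarrow> l"
proof -
  have "(\<lambda>n. (\<Sum>k<Suc n. a k) / real (Suc n) * (1 + 1 / real n) - a 0 / real n) \<longlonglongrightarrow> l * (1 + 0) - 0"
    by (intro tendsto_intros LIMSEQ_Suc[OF assms] lim_1_over_n lim_const_over_n)
  moreover have "\<forall>\<^sub>F n in sequentially. (\<Sum>k<Suc n. a k) / real (Suc n) * (1 + 1 / real n) - a 0 / real n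
      = (\<Sum>k=1..n. a k) / real n"
    using eventually_gt_at_top[of 0]
  proof eventually_elim
    case (elim n)
    have "(\<Sum>k<Suc n. a k) = a 0 + (\<Sum>k=1..n. a k)"
      by (simp add: sum.lessThan_Suc_shift sum.atLeast1_atMost_eq del: sum.lessThan_Suc)
    moreover have "1 + 1 / real n = real (Suc n) / real n" using elim by (simp add: field_simps)
    ultimately show ?case by (simp add: diff_divide_distrib[symmetric] del: sum.lessThan_Suc of_nat_Suc)
  qed
  ultimately show ?thesis by (rule Lim_transform_eventually[THEN tendsto_eq_rhs]) simp
qed

subsection \<open>Convergence of the empirical functions of the residuals\<close>

text \<open>Compare through a rational \<open>q\<close> near \<open>t\<close>: the error is at most
  \<open>C n * \<bar>s n - q\<bar> + \<bar>A n q - a q\<bar> + \<bar>a q - a t\<bar>\<close>, whose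
  limit in \<open>n\<close> is small once \<open>q\<close> is close to \<open>t\<close>.\<close>

lemma tendsto_compose_equi_Lipschitz:
  fixes A :: "nat \<Rightarrow> real \<Rightarrow> real"
  assumes lim: "\<And>q. q \<in> \<rat> \<Longrightarrow> (\<lambda>n. A n q) \<longlonglongrightarrow> a q"
    and lip: "\<And>n u v. \<bar>A n u - A n v\<bar> \<le> C n * \<bar>u - v\<bar>" and C: "C \<longlonglongrightarrow> c"
    and cont: "isCont a t" and s: "s \<longlonglongrightarrow> t"
  shows "(\<lambda>n. A n (s n)) \<longlonglongrightarrow> a t"
proof (rule tendstoI)
  fix e :: real assume "e > 0"
  have "((\<lambda>q. c * \<bar>t - q\<bar> + \<bar>a q - a t\<bar>) \<longlongrightarrow> c * \<bar>t - t\<bar> + \<bar>a t - a t\<bar>) (at t)"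
    by (intro tendsto_intros isContD[OF cont])
  then have "\<forall>\<^sub>F q in at t. c * \<bar>t - q\<bar> + \<bar>a q - a t\<bar> < e"
    using \<open>e > 0\<close> by (intro order_tendstoD(2)[of _ 0]) auto
  then obtain d where d: "d > 0" "\<And>q. q \<noteq> t \<Longrightarrow> dist q t < d \<Longrightarrow> c * \<bar>t - q\<bar> + \<bar>a q - a t\<bar> < e"
    unfolding eventually_at by blast
  obtain q where q: "q \<in> \<rat>" "t < q" "q < t + d"
    using Rats_dense_in_real[of t "t + d"] d(1) by auto
  \<comment> \<open>The zero term \<open>\<bar>a q - a q\<bar>\<close> is kept so that the
    expression matches the termwise limit below.\<close>
  have less: "c * \<bar>t - q\<bar> + \<bar>a q - a q\<bar> + \<bar>a q - a t\<bar> < e"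
    using d(2)[of q] q by (simp add: dist_real_def)
  have "(\<lambda>n. C n * \<bar>s n - q\<bar> + \<bar>A n q - a q\<bar> + \<bar>a q - a t\<bar>)
      \<longlonglongrightarrow> c * \<bar>t - q\<bar> + \<bar>a q - a q\<bar> + \<bar>a q - a t\<bar>"
    by (intro tendsto_intros C s lim q)
  from order_tendstoD(2)[OF this less]
  show "\<forall>\<^sub>F n in sequentially. dist (A n (s n)) (a t) < e"
  proof eventually_elim
    case (elim n)
    then show ?case using lip[of n "s n" q] by (simp add: dist_real_def)
  qed
qed

text \<open>Monotonicity replaces equicontinuity: for a rational \<open>p < t\<close> with
  \<open>g p > b\<close>, eventually \<open>s n > p\<close> and hence
  \<open>f n (s n) \<ge> f n p > b\<close>; the upper half is symmetric.\<close>

lemma tendsto_compose_mono: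
  fixes f :: "nat \<Rightarrow> real \<Rightarrow> real"
  assumes lim: "\<And>q. q \<in> \<rat> \<Longrightarrow> (\<lambda>n. f n q) \<longlonglongrightarrow> g q"
    and mono: "\<And>n. mono (f n)" and cont: "isCont g t" and s: "s \<longlonglongrightarrow> t"
  shows "(\<lambda>n. f n (s n)) \<longlonglongrightarrow> g t"
proof (rule order_tendstoI)
  fix b assume "b < g t"
  then have "\<forall>\<^sub>F p in at t. b < g p" using cont by (intro order_tendstoD(1)) (auto simp: isCont_def)
  then obtain d where d: "d > 0" "\<And>p. p \<noteq> t \<Longrightarrow> dist p t < d \<Longrightarrow> b < g p"
    unfolding eventually_at by blast
  obtain p where p: "p \<in> \<rat>" "t - d < p" "p < t"
    using Rats_dense_in_real[of "t - d" t] d(1) by auto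
  then have "b < g p" using d(2)[of p] by (simp add: dist_real_def)
  from order_tendstoD(1)[OF lim[OF p(1)] this] order_tendstoD(1)[OF s p(3)]
  show "\<forall>\<^sub>F n in sequentially. b < f n (s n)"
    by eventually_elim (meson less_imp_le mono monoD order_less_le_trans)
next
  fix b assume "g t < b"
  then have "\<forall>\<^sub>F p in at t. g p < b" using cont by (intro order_tendstoD(2)) (auto simp: isCont_def)
  then obtain d where d: "d > 0" "\<And>p. p \<noteq> t \<Longrightarrow> dist p t < d \<Longrightarrow> g p < b"
    unfolding eventually_at by blast
  obtain p where p: "p \<in> \<rat>" "t < p" "p < t + d"
    using Rats_dense_in_real[of t "t + d"] d(1) by auto
  then have "g p < b" using d(2)[of p] by (simp add: dist_real_def)
  from order_tendstoD(2)[OF lim[OF p(1)] this] order_tendstoD(2)[OF s p(2)]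
  show "\<forall>\<^sub>F n in sequentially. f n (s n) < b"
    by eventually_elim (meson less_imp_le mono monoD order_le_less_trans)
qed

section \<open>The zero-bias kernel and deterministic bounds for residuals\<close>

lemma zero_bias_kernel_eq:
  "y * (y - t) * indicator {..t} y = - (y * max 0 (t - y))" for y t :: real
  by (auto simp: indicator_def max_def algebra_simps)

text \<open>The estimate \<open>\<bar>y\<bar> \<le> (1 + y^2) / 2\<close> trades the first absolute
  moment for the second, so a mean square of at most \<open>1\<close> makes the average of the bound
  at most \<open>1 + \<bar>t\<bar>\<close>.\<close>

lemma zero_bias_kernel_le: "\<bar>y * max 0 (t - y)\<bar> \<le> y\<^sup>2 + \<bar>t\<bar> * (1 + y\<^sup>2) / 2" for y t :: real
proof -
  have "\<bar>y * max 0 (t - y)\<bar> \<le> \<bar>y\<bar> * (\<bar>t\<bar> + \<bar>y\<bar>)"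
    unfolding abs_mult by (intro mult_left_mono) auto
  also have "\<dots> = y\<^sup>2 + \<bar>t\<bar> * \<bar>y\<bar>" by (simp add: distrib_left power2_eq_square)
  also have "\<bar>y\<bar> \<le> (1 + y\<^sup>2) / 2"
    using zero_le_power2[of "\<bar>y\<bar> - 1"] by (simp add: power2_diff)
  then have "\<bar>t\<bar> * \<bar>y\<bar> \<le> \<bar>t\<bar> * ((1 + y\<^sup>2) / 2)" by (rule mult_left_mono) simp
  finally show ?thesis by simp
qed

lemma sample_variance_eq:
  "sample_variance n x = (\<Sum>k=1..n. (x k)\<^sup>2) / real n - (sample_mean n x)\<^sup>2"
proof (cases "n = 0")
  case False
  let ?m = "sample_mean n x"
  have "(\<Sum>k=1..n. (x k - ?m)\<^sup>2) = (\<Sum>k=1..n. (x k)\<^sup>2) - 2 * ?m * (\<Sum>k=1..n. x k) + n * ?m\<^sup>2"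
    by (simp add: power2_diff sum.distrib sum_subtractf sum_distrib_left mult_ac)
  also have "(\<Sum>k=1..n. x k) = n * ?m" using False by (simp add: sample_mean_def)
  finally show ?thesis using False
    by (simp add: sample_variance_def field_simps power2_eq_square)
qed (simp add: sample_variance_def sample_mean_def)

text \<open>Equality holds for positive variance. For variance zero, division by zero makes all
  residuals \<open>0\<close>, so the inequality covers every path and every \<open>n\<close>, as a
  uniform dominating function requires.\<close>

lemma sum_scaled_residual_power2_le:
  "(\<Sum>j=1..n. (scaled_residual n x j)\<^sup>2) \<le> real n"
proof (cases "sample_variance n x > 0")
  case True
  then have "(\<Sum>j=1..n. (scaled_residual n x j)\<^sup>2)
      = (\<Sum>k=1..n. (x k - sample_mean n x)\<^sup>2) / sample_variance n x"
    by (simp add: scaled_residual_def power_divide sum_divide_distrib)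
  also have "\<dots> = n"
    using True by (cases "n = 0") (auto simp: sample_variance_def field_simps)
  finally show ?thesis by simp
next
  case False
  moreover have "sample_variance n x \<ge> 0" by (auto simp: sample_variance_def intro!: divide_nonneg_nonneg sum_nonneg)
  ultimately show ?thesis by (simp add: scaled_residual_def)
qed

lemma empirical_zero_bias_eq:
  "empirical_zero_bias n y t = - (\<Sum>j=1..n. y j * max 0 (t - y j)) / real n"
  unfolding empirical_zero_bias_def zero_bias_kernel_eq by (simp add: sum_negf)

lemma abs_empirical_zero_bias_le:
  assumes "(\<Sum>j=1..n. (y j)\<^sup>2) \<le> real n"
  shows "\<bar>empirical_zero_bias n y t\<bar> \<le> 1 + \<bar>t\<bar>"
proof (cases "n = 0")
  case False
  have "\<bar>\<Sum>j=1..n. y j * max 0 (t - y j)\<bar> \<le> (\<Sum>j=1..n. (y j)\<^sup>2 + \<bar>t\<bar> * (1 + (y j)\<^sup>2) / 2)"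
    by (rule order_trans[OF sum_abs]) (intro sum_mono zero_bias_kernel_le)
  also have "\<dots> = (\<Sum>j=1..n. (y j)\<^sup>2) + \<bar>t\<bar> * (n + (\<Sum>j=1..n. (y j)\<^sup>2)) / 2"
    by (simp add: sum.distrib flip: sum_distrib_left sum_divide_distrib)
  also have "\<dots> \<le> n + \<bar>t\<bar> * (n + n) / 2"
    using assms by (intro add_mono divide_right_mono mult_left_mono order_refl) auto
  also have "\<dots> = (1 + \<bar>t\<bar>) * n" by (simp add: algebra_simps)
  finally show ?thesis using False by (simp add: empirical_zero_bias_eq pos_divide_le_eq)
qed (simp add: empirical_zero_bias_def)

lemma empirical_cdf_bounds: "0 \<le> empirical_cdf n y t" "empirical_cdf n y t \<le> 1"
proof -
  show "0 \<le> empirical_cdf n y t" by (simp add: empirical_cdf_def sum_nonneg)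
  have "(\<Sum>j=1..n. indicator {..t} (y j) :: real) \<le> (\<Sum>j=1..n. 1)"
    by (intro sum_mono) (simp add: indicator_def)
  then show "empirical_cdf n y t \<le> 1" by (auto simp: empirical_cdf_def divide_le_eq)
qed

lemma empirical_cdf_mono: "mono (empirical_cdf n y)"
  unfolding empirical_cdf_def
  by (intro monoI divide_right_mono sum_mono) (auto simp: indicator_def)

lemma measurable_empirical_cdf [measurable]: "empirical_cdf n y \<in> borel_measurable borel"
  by (rule borel_measurable_mono[OF empirical_cdf_mono])

lemma measurable_empirical_zero_bias [measurable]: "empirical_zero_bias n y \<in> borel_measurable borel"
  unfolding empirical_zero_bias_eq[abs_def] by measurable

section \<open>From standardized residuals back to the raw sample\<close>

lemma
  fixes x :: "nat \<Rightarrow> real"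
  assumes mean: "(\<lambda>n. (\<Sum>k=1..n. x k) / real n) \<longlonglongrightarrow> 0"
    and second: "(\<lambda>n. (\<Sum>k=1..n. (x k)\<^sup>2) / real n) \<longlonglongrightarrow> 1"
  shows sample_mean_tendsto_0: "(\<lambda>n. sample_mean n x) \<longlonglongrightarrow> 0"
    and sample_sd_tendsto_1: "(\<lambda>n. sqrt (sample_variance n x)) \<longlonglongrightarrow> 1"
proof -
  show m: "(\<lambda>n. sample_mean n x) \<longlonglongrightarrow> 0" using mean by (simp add: sample_mean_def)
  have "(\<lambda>n. sqrt ((\<Sum>k=1..n. (x k)\<^sup>2) / real n - (sample_mean n x)\<^sup>2)) \<longlonglongrightarrow> sqrt (1 - 0\<^sup>2)"
    by (intro tendsto_intros second m)
  then show "(\<lambda>n. sqrt (sample_variance n x)) \<longlonglongrightarrow> 1" by (simp add: sample_variance_eq)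
qed

lemma empirical_cdf_scaled_residual:
  assumes "sample_variance n x > 0"
  shows "empirical_cdf n (scaled_residual n x) t
    = empirical_cdf n x (sample_mean n x + sqrt (sample_variance n x) * t)"
  using assms unfolding empirical_cdf_def scaled_residual_def
  by (intro arg_cong2[where f="(/)"] sum.cong refl) (auto simp: indicator_def field_simps)

text \<open>Centering splits each product into a raw zero-bias term and \<open>m\<close> times a
  positive part; the denominator collects one \<open>\<sigma>\<close> from each factor.\<close>

lemma empirical_zero_bias_scaled_residual:
  fixes x n t
  defines "m \<equiv> sample_mean n x" and "\<sigma> \<equiv> sqrt (sample_variance n x)"
  assumes "sample_variance n x > 0"
  shows "empirical_zero_bias n (scaled_residual n x) t
    = - ((\<Sum>j=1..n. x j * max 0 (m + \<sigma> * t - x j)) / real n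
        - m * ((\<Sum>j=1..n. max 0 (m + \<sigma> * t - x j)) / real n)) / \<sigma>\<^sup>2"
proof -
  have \<sigma>: "\<sigma> > 0" using assms by simp
  have "max 0 (t - (x j - m) / \<sigma>) = max 0 (m + \<sigma> * t - x j) / \<sigma>" for j
    using \<sigma> by (simp add: max_def field_simps)
  then have "empirical_zero_bias n (scaled_residual n x) t
    = - (\<Sum>j=1..n. (x j - m) / \<sigma> * (max 0 (m + \<sigma> * t - x j) / \<sigma>)) / real n"
    by (simp add: empirical_zero_bias_eq scaled_residual_def m_def[symmetric] \<sigma>_def[symmetric])
  also have "(\<Sum>j=1..n. (x j - m) / \<sigma> * (max 0 (m + \<sigma> * t - x j) / \<sigma>))
     = ((\<Sum>j=1..n. x j * max 0 (m + \<sigma> * t - x j)) - m * (\<Sum>j=1..n. max 0 (m + \<sigma> * t - x j))) / \<sigma>\<^sup>2"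
    by (simp add: power2_eq_square sum_divide_distrib[symmetric] sum_distrib_left sum_subtractf[symmetric] left_diff_distrib)
  finally show ?thesis by (simp add: diff_divide_distrib mult.commute)
qed

lemma empirical_cdf_scaled_residual_tendsto:
  fixes x :: "nat \<Rightarrow> real"
  assumes mean: "(\<lambda>n. (\<Sum>k=1..n. x k) / real n) \<longlonglongrightarrow> 0"
    and second: "(\<lambda>n. (\<Sum>k=1..n. (x k)\<^sup>2) / real n) \<longlonglongrightarrow> 1"
    and lim: "\<And>q. q \<in> \<rat> \<Longrightarrow> (\<lambda>n. empirical_cdf n x q) \<longlonglongrightarrow> F q"
    and cont: "isCont F t"
  shows "(\<lambda>n. empirical_cdf n (scaled_residual n x) t) \<longlonglongrightarrow> F t"
proof -
  note m = sample_mean_tendsto_0[OF mean second] and \<sigma> = sample_sd_tendsto_1[OF mean second]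
  have "(\<lambda>n. empirical_cdf n x (sample_mean n x + sqrt (sample_variance n x) * t)) \<longlonglongrightarrow> F t"
    using lim empirical_cdf_mono cont
  proof (rule tendsto_compose_mono)
    show "(\<lambda>n. sample_mean n x + sqrt (sample_variance n x) * t) \<longlonglongrightarrow> t"
      using tendsto_add[OF m tendsto_mult_right[OF \<sigma>, of t]] by simp
  qed
  \<comment> \<open>The rescaling identity assumes positive sample variance, which is eventually the
    case because the standard deviation tends to \<open>1\<close>.\<close>
  moreover have "\<forall>\<^sub>F n in sequentially. empirical_cdf n x (sample_mean n x + sqrt (sample_variance n x) * t)
      = empirical_cdf n (scaled_residual n x) t"
    using order_tendstoD(1)[OF \<sigma>, of 0]
    by (auto elim!: eventually_mono simp: empirical_cdf_scaled_residual)
  ultimately show ?thesis by (rule Lim_transform_eventually[THEN tendsto_eq_rhs]) simp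
qed

text \<open>The raw zero-bias average is Lipschitz in its threshold, with the mean of the
  \<open>\<bar>x k\<bar>\<close> as constant; convergence of these constants permits a moving
  threshold. The centering correction vanishes with the sample mean.\<close>

lemma empirical_zero_bias_scaled_residual_tendsto:
  fixes x :: "nat \<Rightarrow> real"
  assumes mean: "(\<lambda>n. (\<Sum>k=1..n. x k) / real n) \<longlonglongrightarrow> 0"
    and second: "(\<lambda>n. (\<Sum>k=1..n. (x k)\<^sup>2) / real n) \<longlonglongrightarrow> 1"
    and abs: "(\<lambda>n. (\<Sum>k=1..n. \<bar>x k\<bar>) / real n) \<longlonglongrightarrow> c"
    and lim: "\<And>q. q \<in> \<rat> \<Longrightarrow> (\<lambda>n. empirical_zero_bias n x q) \<longlonglongrightarrow> f q"
    and cont: "isCont f t"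
  shows "(\<lambda>n. empirical_zero_bias n (scaled_residual n x) t) \<longlonglongrightarrow> f t"
proof -
  note m = sample_mean_tendsto_0[OF mean second] and \<sigma> = sample_sd_tendsto_1[OF mean second]
  define s where "s n = sample_mean n x + sqrt (sample_variance n x) * t" for n
  define B where "B n = (\<Sum>j=1..n. max 0 (s n - x j)) / real n" for n
  have s: "s \<longlonglongrightarrow> t"
    unfolding s_def[abs_def] using tendsto_add[OF m tendsto_mult_right[OF \<sigma>, of t]] by simp
  have A: "(\<lambda>n. empirical_zero_bias n x (s n)) \<longlonglongrightarrow> f t"
    using lim _ abs cont s
  proof (rule tendsto_compose_equi_Lipschitz)
    fix n u v
    have "\<bar>(\<Sum>j=1..n. x j * max 0 (v - x j)) - (\<Sum>j=1..n. x j * max 0 (u - x j))\<bar>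
        \<le> (\<Sum>j=1..n. \<bar>x j * max 0 (v - x j) - x j * max 0 (u - x j)\<bar>)"
      unfolding sum_subtractf[symmetric] by (rule sum_abs)
    also have "\<dots> \<le> (\<Sum>j=1..n. \<bar>x j\<bar> * \<bar>u - v\<bar>)"
      unfolding right_diff_distrib[symmetric] abs_mult by (intro sum_mono mult_left_mono) auto
    finally show "\<bar>empirical_zero_bias n x u - empirical_zero_bias n x v\<bar>
        \<le> (\<Sum>k=1..n. \<bar>x k\<bar>) / real n * \<bar>u - v\<bar>"
      by (simp add: empirical_zero_bias_eq diff_divide_distrib[symmetric] divide_right_mono
          flip: sum_distrib_right)
  qed
  have "(\<lambda>n. sample_mean n x * B n) \<longlonglongrightarrow> 0"
  proof (rule Lim_null_comparison)
    show "(\<lambda>n. \<bar>sample_mean n x\<bar> * (\<bar>s n\<bar> + (\<Sum>k=1..n. \<bar>x k\<bar>) / real n)) \<longlonglongrightarrow> 0"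
      using tendsto_mult[OF tendsto_rabs[OF m] tendsto_add[OF tendsto_rabs[OF s] abs]] by simp
    show "\<forall>\<^sub>F n in sequentially. norm (sample_mean n x * B n)
        \<le> \<bar>sample_mean n x\<bar> * (\<bar>s n\<bar> + (\<Sum>k=1..n. \<bar>x k\<bar>) / real n)"
      using eventually_gt_at_top[of 0]
    proof eventually_elim
      case (elim n)
      have "\<bar>\<Sum>j=1..n. max 0 (s n - x j)\<bar> \<le> (\<Sum>j=1..n. \<bar>s n\<bar> + \<bar>x j\<bar>)"
        by (rule order_trans[OF sum_abs]) (intro sum_mono, auto)
      also have "\<dots> = n * \<bar>s n\<bar> + (\<Sum>k=1..n. \<bar>x k\<bar>)" by (simp add: sum.distrib)
      finally have "\<bar>B n\<bar> \<le> \<bar>s n\<bar> + (\<Sum>k=1..n. \<bar>x k\<bar>) / real n"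
        using elim by (simp add: B_def field_simps)
      then show ?case by (simp add: abs_mult mult_left_mono)
    qed
  qed
  with A \<sigma> have "(\<lambda>n. (empirical_zero_bias n x (s n) + sample_mean n x * B n) / (sqrt (sample_variance n x))\<^sup>2)
      \<longlonglongrightarrow> (f t + 0) / 1\<^sup>2"
    by (intro tendsto_intros) auto
  moreover have "\<forall>\<^sub>F n in sequentially.
      (empirical_zero_bias n x (s n) + sample_mean n x * B n) / (sqrt (sample_variance n x))\<^sup>2
      = empirical_zero_bias n (scaled_residual n x) t"
    using order_tendstoD(1)[OF \<sigma> zero_less_one]
  proof eventually_elim
    case (elim n)
    then have "sample_variance n x > 0" by simp
    then show ?case
      by (subst empirical_zero_bias_scaled_residual)
         (simp_all add: empirical_zero_bias_eq s_def B_def)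
  qed
  ultimately show ?thesis by (rule Lim_transform_eventually[THEN tendsto_eq_rhs]) simp
qed

subsection \<open>Convergence of the test statistics\<close>

text \<open>Continuity bounds \<open>\<omega>\<close> near the origin, where \<open>t ^ 4\<close> gives no control.\<close>

lemma integrable_weight:
  fixes \<omega> :: "real \<Rightarrow> real"
  assumes cont: "continuous_on UNIV \<omega>" and nonneg: "\<And>t. \<omega> t \<ge> 0"
    and fourth: "integrable lborel (\<lambda>t. t ^ 4 * \<omega> t)"
  shows "integrable lborel (\<lambda>t. (2 + \<bar>t\<bar>)\<^sup>2 * \<omega> t)"
proof -
  have [measurable]: "\<omega> \<in> borel_measurable borel" by (rule borel_measurable_continuous_onI[OF cont])
  have "set_integrable lborel {-1..1} \<omega>"
    by (rule borel_integrable_atLeastAtMost') (rule continuous_on_subset[OF cont], simp)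
  then have "integrable lborel (\<lambda>t. indicator {-1..1} t * \<omega> t)" by (simp add: set_integrable_def)
  \<comment> \<open>The constant is \<open>9 = 3^2\<close>: \<open>2 + \<bar>t\<bar> \<le> 3\<close>
    on \<open>{-1..1}\<close>, and outside \<open>2 + \<bar>t\<bar> \<le> 3 * \<bar>t\<bar>\<close>
    with \<open>t^2 \<le> t^4\<close>.\<close>
  then have "integrable lborel (\<lambda>t. 9 * (indicator {-1..1} t * \<omega> t) + 9 * (t ^ 4 * \<omega> t))"
    using fourth by simp
  then show ?thesis
  proof (rule Bochner_Integration.integrable_bound)
    show "AE t in lborel. norm ((2 + \<bar>t\<bar>)\<^sup>2 * \<omega> t)
        \<le> norm (9 * (indicator {-1..1} t * \<omega> t) + 9 * (t ^ 4 * \<omega> t))"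
    proof (rule AE_I2)
      fix t :: real
      have "(2 + \<bar>t\<bar>)\<^sup>2 \<le> 9 * indicator {-1..1} t + 9 * t ^ 4"
      proof (cases "\<bar>t\<bar> \<le> 1")
        case True
        then have "(2 + \<bar>t\<bar>)\<^sup>2 \<le> 3\<^sup>2" by (intro power_mono) auto
        moreover have "0 \<le> t ^ 4" by simp
        ultimately show ?thesis using True by (simp add: abs_le_iff del: zero_le_power_eq_numeral)
      next
        case False
        then have "(2 + \<bar>t\<bar>)\<^sup>2 \<le> (3 * \<bar>t\<bar>)\<^sup>2" by (intro power_mono) auto
        also have "\<dots> = 9 * t\<^sup>2" by (simp add: power_mult_distrib)
        also have "t\<^sup>2 \<le> t ^ 4"
          using power_increasing[of 2 4 "\<bar>t\<bar>"] False by simp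
        finally show ?thesis by (simp add: indicator_def)
      qed
      then have "(2 + \<bar>t\<bar>)\<^sup>2 * \<omega> t \<le> (9 * indicator {-1..1} t + 9 * t ^ 4) * \<omega> t"
        by (rule mult_right_mono) (rule nonneg)
      moreover have "0 \<le> (2 + \<bar>t\<bar>)\<^sup>2 * \<omega> t" by (simp add: nonneg)
      ultimately show "norm ((2 + \<bar>t\<bar>)\<^sup>2 * \<omega> t)
        \<le> norm (9 * (indicator {-1..1} t * \<omega> t) + 9 * (t ^ 4 * \<omega> t))"
        by (simp add: algebra_simps)
    qed
  qed measurable
qed

section \<open>Integration against the weight\<close>

lemma power2_weight_le:
  fixes u b v :: real
  assumes "\<bar>u\<bar> \<le> b" "v \<ge> 0"
  shows "norm (u\<^sup>2 * v) \<le> b\<^sup>2 * v"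
  using assms power_mono[of "\<bar>u\<bar>" b 2] by (simp add: abs_mult mult_right_mono)

lemma linear_growth_in_L2_space:
  assumes "integrable lborel (\<lambda>t. (2 + \<bar>t\<bar>)\<^sup>2 * \<omega> t)" "\<And>t. \<omega> t \<ge> 0"
    "\<omega> \<in> borel_measurable borel" "f \<in> borel_measurable borel"
    "\<And>t. \<bar>f t\<bar> \<le> 2 + \<bar>t\<bar>"
  shows "f \<in> L2_space \<omega>"
proof -
  note [measurable] = assms(3,4)
  have "integrable lborel (\<lambda>t. (f t)\<^sup>2 * \<omega> t)"
    using assms(1)
  proof (rule Bochner_Integration.integrable_bound)
    show "AE t in lborel. norm ((f t)\<^sup>2 * \<omega> t) \<le> norm ((2 + \<bar>t\<bar>)\<^sup>2 * \<omega> t)"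
      using power2_weight_le[OF assms(5) assms(2)] assms(2) by simp
  qed measurable
  then show ?thesis by (simp add: L2_space_def)
qed

text \<open>The pattern \<open>real n * ... / real n\<close> is the literal form of the normalized
  statistics; the factors cancel for \<open>n > 0\<close>.\<close>

lemma tendsto_weighted_L2_integral:
  assumes "integrable lborel (\<lambda>t. (2 + \<bar>t\<bar>)\<^sup>2 * \<omega> t)" "\<And>t. \<omega> t \<ge> 0"
    "\<omega> \<in> borel_measurable borel" "f \<in> borel_measurable borel"
    "\<And>n. g n \<in> borel_measurable borel" "\<And>n t. \<bar>g n t\<bar> \<le> 2 + \<bar>t\<bar>"
    "AE t in lborel. (\<lambda>n. g n t) \<longlonglongrightarrow> f t"
  shows "(\<lambda>n. real n * (LINT t|lborel. (g n t)\<^sup>2 * \<omega> t) / real n) \<longlonglongrightarrow> (LINT t|lborel. (f t)\<^sup>2 * \<omega> t)"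
proof -
  note [measurable] = assms(3-5)
  have "(\<lambda>n. LINT t|lborel. (g n t)\<^sup>2 * \<omega> t) \<longlonglongrightarrow> (LINT t|lborel. (f t)\<^sup>2 * \<omega> t)"
  proof (rule integral_dominated_convergence[OF _ _ assms(1)])
    show "AE t in lborel. (\<lambda>n. (g n t)\<^sup>2 * \<omega> t) \<longlonglongrightarrow> (f t)\<^sup>2 * \<omega> t"
      using assms(7) by eventually_elim (intro tendsto_intros)
    show "AE t in lborel. norm ((g n t)\<^sup>2 * \<omega> t) \<le> (2 + \<bar>t\<bar>)\<^sup>2 * \<omega> t" for n
      by (intro AE_I2 power2_weight_le assms)
  qed measurable
  then show ?thesis
    by (rule Lim_transform_eventually)
       (rule eventually_mono[OF eventually_gt_at_top[of 0]], simp)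
qed

section \<open>The zero-bias distribution function of the population\<close>

lemma (in prob_space) zero_bias_cdf_eq:
  assumes "X \<in> borel_measurable M"
  shows "zero_bias_cdf M X t = - expectation (\<lambda>w. X w * max 0 (t - X w))"
  unfolding zero_bias_cdf_def zero_bias_kernel_eq by simp

lemma (in prob_space) integrable_zero_bias_kernel:
  fixes X :: "'a \<Rightarrow> real"
  assumes [measurable]: "X \<in> borel_measurable M" and sq: "integrable M (\<lambda>w. (X w)\<^sup>2)"
  shows "integrable M (\<lambda>w. X w * max 0 (t - X w))"
proof (rule Bochner_Integration.integrable_bound)
  show "integrable M (\<lambda>w. (X w)\<^sup>2 + \<bar>t\<bar> * (1 + (X w)\<^sup>2) / 2)" using sq by simp
  show "AE w in M. norm (X w * max 0 (t - X w)) \<le> norm ((X w)\<^sup>2 + \<bar>t\<bar> * (1 + (X w)\<^sup>2) / 2)"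
    by (intro AE_I2) (metis real_norm_def zero_bias_kernel_le abs_ge_self order_trans)
qed measurable

lemma (in prob_space) abs_zero_bias_cdf_le:
  fixes X :: "'a \<Rightarrow> real"
  assumes [measurable]: "X \<in> borel_measurable M" and sq: "integrable M (\<lambda>w. (X w)\<^sup>2)"
    and one: "expectation (\<lambda>w. (X w)\<^sup>2) = 1"
  shows "\<bar>zero_bias_cdf M X t\<bar> \<le> 1 + \<bar>t\<bar>"
proof -
  have "\<bar>expectation (\<lambda>w. X w * max 0 (t - X w))\<bar>
      \<le> expectation (\<lambda>w. \<bar>X w * max 0 (t - X w)\<bar>)"
    by (rule integral_abs_bound)
  also have "\<dots> \<le> expectation (\<lambda>w. (X w)\<^sup>2 + \<bar>t\<bar> * (1 + (X w)\<^sup>2) / 2)"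
    by (intro integral_mono integrable_abs integrable_zero_bias_kernel zero_bias_kernel_le) (use sq in simp_all)
  also have "\<dots> = 1 + \<bar>t\<bar>" using sq by (simp add: one prob_space)
  finally show ?thesis by (simp add: zero_bias_cdf_eq)
qed

text \<open>Averaging the Lipschitz bound of the kernel gives the constant
  \<open>E \<bar>X\<bar>\<close>, finite because square integrability implies integrability on a
  probability space.\<close>

lemma (in prob_space) continuous_zero_bias_cdf:
  fixes X :: "'a \<Rightarrow> real"
  assumes [measurable]: "X \<in> borel_measurable M" and sq: "integrable M (\<lambda>w. (X w)\<^sup>2)"
  shows "continuous_on UNIV (zero_bias_cdf M X)"
proof -
  have int: "integrable M X" using sq by (rule square_integrable_imp_integrable[rotated]) simp
  have "(expectation (\<lambda>w. \<bar>X w\<bar>))-lipschitz_on UNIV (zero_bias_cdf M X)"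
  proof (rule lipschitz_onI)
    fix u v :: real
    have "dist (zero_bias_cdf M X u) (zero_bias_cdf M X v)
        = \<bar>expectation (\<lambda>w. X w * max 0 (v - X w) - X w * max 0 (u - X w))\<bar>"
      by (simp add: zero_bias_cdf_eq dist_real_def integrable_zero_bias_kernel sq)
    also have "\<dots> \<le> expectation (\<lambda>w. \<bar>X w * max 0 (v - X w) - X w * max 0 (u - X w)\<bar>)"
      by (rule integral_abs_bound)
    also have "\<dots> \<le> expectation (\<lambda>w. \<bar>X w\<bar> * \<bar>u - v\<bar>)"
    proof (rule integral_mono)
      show "integrable M (\<lambda>w. \<bar>X w * max 0 (v - X w) - X w * max 0 (u - X w)\<bar>)"
        by (intro integrable_abs Bochner_Integration.integrable_diff integrable_zero_bias_kernel sq) simp_all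
      show "\<bar>X w * max 0 (v - X w) - X w * max 0 (u - X w)\<bar> \<le> \<bar>X w\<bar> * \<bar>u - v\<bar>" for w
        unfolding right_diff_distrib[symmetric] abs_mult by (intro mult_left_mono) auto
    qed (use int in simp)
    finally show "dist (zero_bias_cdf M X u) (zero_bias_cdf M X v) \<le> expectation (\<lambda>w. \<bar>X w\<bar>) * dist u v"
      by (simp add: dist_real_def)
  qed simp
  then show ?thesis by (rule lipschitz_on_continuous_on)
qed

text \<open>\<open>Xs(0 := X)\<close> stores \<open>X\<close> at the free index \<open>0\<close>, so
  one family expresses joint independence and every member has the law of \<open>X\<close>. Passing
  to sums from \<open>1\<close> then discards that entry.\<close>

lemma (in prob_space) strong_law_of_large_numbers_from_1:
  fixes X :: "'a \<Rightarrow> real" and f :: "real \<Rightarrow> real"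
  assumes ind: "indep_vars (\<lambda>_. borel) (Xs(0 := X)) (UNIV :: nat set)"
    and D: "\<And>k. k \<ge> 1 \<Longrightarrow> distr M borel (Xs k) = distr M borel X"
    and [measurable]: "f \<in> borel_measurable borel" and f: "integrable M (\<lambda>w. f (X w))"
  shows "AE w in M. (\<lambda>n. (\<Sum>k=1..n. f (Xs k w)) / real n) \<longlonglongrightarrow> expectation (\<lambda>w. f (X w))"
proof -
  have [measurable]: "X \<in> borel_measurable M"
    using ind by (auto simp: indep_vars_def dest: spec[of _ 0])
  have "AE w in M. (\<lambda>n. (\<Sum>k<n. f ((Xs(0 := X)) k w)) / real n) \<longlonglongrightarrow> integral\<^sup>L (distr M borel X) f"
    using ind by (rule strong_law_of_large_numbers) (use D f in \<open>auto simp: integrable_distr_eq\<close>)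
  then show ?thesis
  proof eventually_elim
    case (elim w)
    from tendsto_average_from_1[OF elim] show ?case by (simp add: integral_distr)
  qed
qed

text \<open>Membership in \<open>L2_space\<close> accompanies each limit because the integral of a
  nonintegrable function is \<open>0\<close> by default; it certifies that the norms are
  genuine.\<close>

theorem theorem3p1:
  fixes M :: "'a measure"
    and X :: "'a \<Rightarrow> real"
    and Xs :: "nat \<Rightarrow> 'a \<Rightarrow> real"
    and \<omega> F FX :: "real \<Rightarrow> real"
  assumes "continuous_on UNIV \<omega>"
    and "\<And>t. \<omega> t > 0"
    and "integrable lborel (\<lambda>t. t ^ 4 * \<omega> t)"
    and "prob_space M"
    and "prob_space.indep_vars M (\<lambda>_. borel) (Xs(0 := X)) UNIV"
    and "\<And>k. k \<ge> 1 \<Longrightarrow> distr M borel (Xs k) = distr M borel X"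
    and "integrable M (\<lambda>w. (X w)\<^sup>2)"
    and "prob_space.expectation M X = 0"
    and "prob_space.variance M X = 1"
    and "F = cdf (distr M borel X)"
    and "FX = zero_bias_cdf M X"
  shows "(\<lambda>s. FX s - F s) \<in> L2_space \<omega>
    \<and> (AE w in M. (\<lambda>n. G1 \<omega> n (\<lambda>k. Xs k w) / real n)
          \<longlonglongrightarrow> (LINT s|lborel. (FX s - F s)\<^sup>2 * \<omega> s))
    \<and> (LINT s|lborel. (FX s - F s)\<^sup>2 * \<omega> s) = (L2_norm \<omega> (\<lambda>s. FX s - F s))\<^sup>2
    \<and> (L2_norm \<omega> (\<lambda>s. FX s - F s))\<^sup>2 = Delta1 \<omega> M X
    \<and> (\<lambda>s. FX s - std_normal_cdf s) \<in> L2_space \<omega>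
    \<and> (AE w in M. (\<lambda>n. G2 \<omega> n (\<lambda>k. Xs k w) / real n)
          \<longlonglongrightarrow> (LINT s|lborel. (FX s - std_normal_cdf s)\<^sup>2 * \<omega> s))
    \<and> (LINT s|lborel. (FX s - std_normal_cdf s)\<^sup>2 * \<omega> s)
        = (L2_norm \<omega> (\<lambda>s. FX s - std_normal_cdf s))\<^sup>2
    \<and> (L2_norm \<omega> (\<lambda>s. FX s - std_normal_cdf s))\<^sup>2 = Delta2 \<omega> M X"
proof -
  interpret prob_space M by fact
  note ind = assms(5) and iid = assms(6) and sq = assms(7)
  note F = \<open>F = cdf (distr M borel X)\<close> and FX = \<open>FX = zero_bias_cdf M X\<close>
  have nonneg: "\<omega> t \<ge> 0" for t using assms(2)[of t] by simp
  have [measurable]: "\<omega> \<in> borel_measurable borel"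
    by (rule borel_measurable_continuous_onI) fact
  have X[measurable]: "X \<in> borel_measurable M"
    using ind by (auto simp: indep_vars_def dest: spec[of _ 0])
  have X_int: "integrable M X" using sq by (rule square_integrable_imp_integrable[rotated]) simp
  have sq_1: "expectation (\<lambda>w. (X w)\<^sup>2) = 1" using assms(8,9) by simp
  interpret D: real_distribution "distr M borel X" by (rule real_distribution_distr) simp
  interpret N: real_distribution std_normal_distribution
    by (rule real_dist_normal_dist)
  note weight = integrable_weight[OF assms(1) nonneg assms(3)]
  note L2 = linear_growth_in_L2_space[OF weight nonneg]
    and lim = tendsto_weighted_L2_integral[OF weight nonneg]
  have cont: "isCont FX t" for t
    using continuous_zero_bias_cdf[OF X sq] by (simp add: FX continuous_on_eq_continuous_at)
  have FX_meas[measurable]: "FX \<in> borel_measurable borel"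
    unfolding FX by (intro borel_measurable_continuous_onI continuous_zero_bias_cdf X sq)
  have F_meas[measurable]: "F \<in> borel_measurable borel"
    unfolding F by (intro borel_measurable_mono monoI D.cdf_nondecreasing)
  have Phi_meas[measurable]: "std_normal_cdf \<in> borel_measurable borel"
    unfolding std_normal_cdf_def by (intro borel_measurable_mono monoI N.cdf_nondecreasing)
  have F_bounds: "0 \<le> F t" "F t \<le> 1" for t
    unfolding F using D.cdf_nonneg D.cdf_bounded_prob by auto
  have Phi_bounds: "0 \<le> std_normal_cdf t" "std_normal_cdf t \<le> 1" for t
    unfolding std_normal_cdf_def using N.cdf_nonneg N.cdf_bounded_prob by auto
  have FX_le: "\<bar>FX t\<bar> \<le> 1 + \<bar>t\<bar>" for t
    unfolding FX by (rule abs_zero_bias_cdf_le[OF X sq sq_1])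
  have EZB_le: "\<bar>empirical_zero_bias n (scaled_residual n x) t\<bar> \<le> 1 + \<bar>t\<bar>" for n x t
    by (rule abs_empirical_zero_bias_le[OF sum_scaled_residual_power2_le])
  \<comment> \<open>Discontinuities of \<open>F\<close> are the atoms of the law of
    \<open>X\<close>, a countable and hence Lebesgue null set; convergence at almost every
    \<open>t\<close> suffices under the integral.\<close>
  have F_cont: "AE t in lborel. isCont F t"
  proof (rule AE_mp[OF AE_not_in])
    show "{t. measure (distr M borel X) {t} > 0} \<in> null_sets lborel"
      by (rule countable_imp_null_set_lborel[OF D.countable_atoms])
    show "AE t in lborel. t \<notin> {t. measure (distr M borel X) {t} > 0} \<longrightarrow> isCont F t"
      unfolding F D.isCont_cdf by (auto simp: not_less measure_le_0_iff)
  qed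
  note slln = strong_law_of_large_numbers_from_1[OF ind iid]
  have "AE w in M. (\<lambda>n. (\<Sum>k=1..n. Xs k w) / real n) \<longlonglongrightarrow> 0"
    using slln[of "\<lambda>x. x"] X_int assms(8) by simp
  moreover have "AE w in M. (\<lambda>n. (\<Sum>k=1..n. (Xs k w)\<^sup>2) / real n) \<longlonglongrightarrow> 1"
    using slln[of "\<lambda>x. x\<^sup>2"] sq sq_1 by simp
  moreover have "AE w in M. (\<lambda>n. (\<Sum>k=1..n. \<bar>Xs k w\<bar>) / real n) \<longlonglongrightarrow> expectation (\<lambda>w. \<bar>X w\<bar>)"
    using slln[of "\<lambda>x. \<bar>x\<bar>"] X_int by simp
  \<comment> \<open>Rational thresholds leave countably many exceptional events, so a single null
    set covers them all.\<close>
  moreover have "AE w in M. \<forall>q\<in>\<rat>. (\<lambda>n. empirical_zero_bias n (\<lambda>k. Xs k w) q) \<longlonglongrightarrow> FX q"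
  proof (rule AE_ball_countable[OF countable_rat, THEN iffD2], intro ballI)
    fix q :: real
    have "integrable M (\<lambda>w. X w * (X w - q) * indicator {..q} (X w))"
      unfolding zero_bias_kernel_eq using integrable_zero_bias_kernel[OF X sq] by simp
    then show "AE w in M. (\<lambda>n. empirical_zero_bias n (\<lambda>k. Xs k w) q) \<longlonglongrightarrow> FX q"
      unfolding empirical_zero_bias_def FX zero_bias_cdf_def by (intro slln) measurable
  qed
  moreover have "AE w in M. \<forall>q\<in>\<rat>. (\<lambda>n. empirical_cdf n (\<lambda>k. Xs k w) q) \<longlonglongrightarrow> F q"
  proof (rule AE_ball_countable[OF countable_rat, THEN iffD2], intro ballI)
    fix q :: real
    have "integrable M (\<lambda>w. indicator {..q} (X w) :: real)"
      by (rule integrable_const_bound[of _ 1]) (auto simp: indicator_def)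
    moreover have "F q = expectation (\<lambda>w. indicator {..q} (X w))"
      unfolding F cdf_def by (subst integral_distr[OF X, symmetric]) simp_all
    ultimately show "AE w in M. (\<lambda>n. empirical_cdf n (\<lambda>k. Xs k w) q) \<longlonglongrightarrow> F q"
      unfolding empirical_cdf_def using slln[of "indicator {..q}"] by simp
  qed
  \<comment> \<open>All these limits hold simultaneously off one null set; there the observations
    form a fixed real sequence and the deterministic limit lemmas apply.\<close>
  ultimately have G: "AE w in M.
      (\<lambda>n. G1 \<omega> n (\<lambda>k. Xs k w) / real n) \<longlonglongrightarrow> (LINT s|lborel. (FX s - F s)\<^sup>2 * \<omega> s)
      \<and> (\<lambda>n. G2 \<omega> n (\<lambda>k. Xs k w) / real n) \<longlonglongrightarrow> (LINT s|lborel. (FX s - std_normal_cdf s)\<^sup>2 * \<omega> s)"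
  proof eventually_elim
    case (elim w)
    note FX_lim = empirical_zero_bias_scaled_residual_tendsto
      [OF elim(1-3) elim(4)[rule_format] cont]
    show ?case
    proof
      show "(\<lambda>n. G1 \<omega> n (\<lambda>k. Xs k w) / real n) \<longlonglongrightarrow> (LINT s|lborel. (FX s - F s)\<^sup>2 * \<omega> s)"
        unfolding G1_def
      proof (rule lim)
        show "\<bar>empirical_zero_bias n (scaled_residual n (\<lambda>k. Xs k w)) t
            - empirical_cdf n (scaled_residual n (\<lambda>k. Xs k w)) t\<bar> \<le> 2 + \<bar>t\<bar>" for n t
          using EZB_le[of n "\<lambda>k. Xs k w" t] empirical_cdf_bounds[of n "scaled_residual n (\<lambda>k. Xs k w)" t]
          by linarith
        show "AE t in lborel. (\<lambda>n. empirical_zero_bias n (scaled_residual n (\<lambda>k. Xs k w)) t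
            - empirical_cdf n (scaled_residual n (\<lambda>k. Xs k w)) t) \<longlonglongrightarrow> FX t - F t"
          using F_cont
          by eventually_elim
             (intro tendsto_diff FX_lim
               empirical_cdf_scaled_residual_tendsto[OF elim(1,2) elim(5)[rule_format]])
      qed measurable
      show "(\<lambda>n. G2 \<omega> n (\<lambda>k. Xs k w) / real n) \<longlonglongrightarrow> (LINT s|lborel. (FX s - std_normal_cdf s)\<^sup>2 * \<omega> s)"
        unfolding G2_def
      proof (rule lim)
        show "\<bar>empirical_zero_bias n (scaled_residual n (\<lambda>k. Xs k w)) t - std_normal_cdf t\<bar> \<le> 2 + \<bar>t\<bar>" for n t
          using EZB_le[of n "\<lambda>k. Xs k w" t] Phi_bounds[of t] by linarith
        show "AE t in lborel. (\<lambda>n. empirical_zero_bias n (scaled_residual n (\<lambda>k. Xs k w)) t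
            - std_normal_cdf t) \<longlonglongrightarrow> FX t - std_normal_cdf t"
          by (intro AE_I2 tendsto_diff FX_lim tendsto_const)
      qed measurable
    qed
  qed
  have norm: "(LINT s|lborel. (f s)\<^sup>2 * \<omega> s) = (L2_norm \<omega> f)\<^sup>2" for f
    by (simp add: L2_norm_def integral_nonneg nonneg)
  have "(\<lambda>s. FX s - F s) \<in> L2_space \<omega>"
  proof (rule L2)
    show "\<bar>FX t - F t\<bar> \<le> 2 + \<bar>t\<bar>" for t using FX_le[of t] F_bounds[of t] by linarith
  qed measurable
  moreover have "(\<lambda>s. FX s - std_normal_cdf s) \<in> L2_space \<omega>"
  proof (rule L2)
    show "\<bar>FX t - std_normal_cdf t\<bar> \<le> 2 + \<bar>t\<bar>" for t using FX_le[of t] Phi_bounds[of t] by linarith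
  qed measurable
  ultimately show ?thesis
    using G by (simp add: norm Delta1_def Delta2_def F FX AE_conj_iff)
qed

end
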